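(* Let $(R,\cdot,(P_\omega)_{\omega\in S},\theta)$ be a Rota-Baxter family Hom-associative algebra of weight $\lambda$, $E$ a vector space containing $R$ as a subspace, $\rho:E\to R$ a linear retraction (a linear map with $\rho(a)=a$ for all $a\in R$), and $V=\ker\rho$. Then the map $\Upsilon_1:\mathbf{Exts}(E,R)\to\mathcal{O}(R,V)$ sending an extension $(E,\cdot_E,(P_{\omega,E})_{\omega\in S},\theta_E)$ to $\Omega(R,V)=(\triangleright,\triangleleft,\rightharpoonup,\leftharpoonup,f,\cdot_V,(Q_\omega)_{\omega\in S},(P_{\omega,V})_{\omega\in S},\eta,\theta_V)$, where for $a\in R$, $x,y\in V$, $\omega\in S$ $$\begin{aligned}a\triangleright x&=a\cdot_E x-\rho(a\cdot_E x),& x\triangleleft a&=x\cdot_E a-\rho(x\cdot_E a),\\ a\leftharpoonup x&=\rho(a\cdot_E x),& x\rightharpoonup a&=\rho(x\cdot_E a),\\ f(x,y)&=\rho(x\cdot_E y),& x\cdot_V y&=x\cdot_E y-\rho(x\cdot_E y),\\ Q_\omega(x)&=\rho(P_{\omega,E}(x)),& P_{\omega,V}(x)&=P_{\omega,E}(x)-\rho(P_{\omega,E}(x)),\\ \eta(x)&=\rho(\theta_E(x)),& \theta_V(x)&=\theta_E(x)-\rho(\theta_E(x)),\end{aligned}$$ is bijective.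
   Context: Fix a field $\mathbf{k}$, a semigroup $S$ and $\lambda\in\mathbf{k}$. All vector spaces and (bi)linear maps are over $\mathbf{k}$. A Rota-Baxter family Hom-associative algebra (of weight $\lambda$) is a 4-tuple $(R,\cdot,(P_\omega)_{\omega\in S},\theta)$, with $R$ a vector space, $\cdot:R\times R\to R$ bilinear, $P_\omega:R\to R$ ($\omega\in S$) and $\theta:R\to R$ linear, such that for all $x,y,z\in R$ and $\omega,\alpha,\beta\in S$: $\theta(x)\cdot(y\cdot z)=(x\cdot y)\cdot\theta(z)$; $P_\alpha(x)\cdot P_\beta(y)=P_{\alpha\beta}(P_\alpha(x)\cdot y+x\cdot P_\beta(y)+\lambda\,x\cdot y)$; $P_\omega(\theta(x))=\theta(P_\omega(x))$. $\mathbf{Exts}(E,R)$ is the set of extensions of $R$ on $E$: all Rota-Baxter family Hom-associative algebra structures $(E,\cdot_E,(P_{\omega,E})_{\omega\in S},\theta_E)$ of weight $\lambda$ on the vector space $E$ containing $R$ as a subalgebra, i.e. such that $\cdot_E,P_{\omega,E},\theta_E$ restrict on $R$ to $\cdot,P_\omega,\theta$. Extending datum of $R$ through a vector space $V$: a system $\Omega(R,V)=(\triangleright,\triangleleft,\rightharpoonup,\leftharpoonup,f,\cdot_V,(Q_\omega)_{\omega\in S},(P_{\omega,V})_{\omega\in S},\eta,\theta_V)$ of bilinear maps $\triangleright:R\times V\to V$, $\triangleleft:V\times R\to V$, $\rightharpoonup:V\times R\to R$, $\leftharpoonup:R\times V\to R$, $f:V\times V\to R$, $\cdot_V:V\times V\to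 V$ and linear maps $Q_\omega:V\to R$, $P_{\omega,V}:V\to V$ ($\omega\in S$), $\eta:V\to R$, $\theta_V:V\to V$. On $R\times V$ define $(a,x)\,\bar\cdot\,(b,y)=(ab+a\leftharpoonup y+x\rightharpoonup b+f(x,y),\ a\triangleright y+x\triangleleft b+x\cdot_V y)$, $\bar P_\omega(a,x)=(P_\omega(a)+Q_\omega(x),P_{\omega,V}(x))$, $\bar\theta(a,x)=(\theta(a)+\eta(x),\theta_V(x))$. The datum is called a Rota-Baxter family Hom extending structure of $R$ through $V$ if $(R\times V,\bar\cdot,(\bar P_\omega)_{\omega\in S},\bar\theta)$ is a Rota-Baxter family Hom-associative algebra of weight $\lambda$. $\mathcal{O}(R,V)$ denotes the set of all Rota-Baxter family Hom extending structures of $R$ through $V$. *)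

theory Defs
  imports "HOL-Analysis.Product_Vector" "HOL-Library.FuncSet"
begin

text \<open>
  Vector spaces are subspaces (carrier sets) of an ambient vector space given by the locale
  \<^locale>\<open>vector_space\<close> over a field. A semigroup is a type of class \<^class>\<open>semigroup_mult\<close>.
\<close>

definition linear_map_on ::
    "('k::field \<Rightarrow> 'a::ab_group_add \<Rightarrow> 'a) \<Rightarrow> ('k \<Rightarrow> 'b::ab_group_add \<Rightarrow> 'b) \<Rightarrow>
     'a set \<Rightarrow> 'b set \<Rightarrow> ('a \<Rightarrow> 'b) \<Rightarrow> bool" where
  "linear_map_on s1 s2 A B f \<longleftrightarrow>
     f \<in> A \<rightarrow> B \<and>
     (\<forall>x\<in>A. \<forall>y\<in>A. f (x + y) = f x + f y) \<and>
     (\<forall>c. \<forall>x\<in>A. f (s1 c x) = s2 c (f x))"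

definition bilinear_map_on ::
    "('k::field \<Rightarrow> 'a::ab_group_add \<Rightarrow> 'a) \<Rightarrow> ('k \<Rightarrow> 'b::ab_group_add \<Rightarrow> 'b) \<Rightarrow>
     ('k \<Rightarrow> 'c::ab_group_add \<Rightarrow> 'c) \<Rightarrow>
     'a set \<Rightarrow> 'b set \<Rightarrow> 'c set \<Rightarrow> ('a \<Rightarrow> 'b \<Rightarrow> 'c) \<Rightarrow> bool" where
  "bilinear_map_on s1 s2 s3 A B C f \<longleftrightarrow>
     (\<forall>x\<in>A. linear_map_on s2 s3 B C (\<lambda>y. f x y)) \<and>
     (\<forall>y\<in>B. linear_map_on s1 s3 A C (\<lambda>x. f x y))"

record ('s, 'a) rbf_struct =
  rmult :: "'a \<Rightarrow> 'a \<Rightarrow> 'a"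
  rbop :: "'s \<Rightarrow> 'a \<Rightarrow> 'a"
  rtwist :: "'a \<Rightarrow> 'a"

definition rbf_hom_assoc_algebra ::
    "('k::field \<Rightarrow> 'a::ab_group_add \<Rightarrow> 'a) \<Rightarrow> 'k \<Rightarrow> 'a set \<Rightarrow>
     ('s::semigroup_mult, 'a) rbf_struct \<Rightarrow> bool" where
  "rbf_hom_assoc_algebra scl lam A M \<longleftrightarrow>
     vector_space scl \<and> module.subspace scl A \<and>
     bilinear_map_on scl scl scl A A A (rmult M) \<and>
     (\<forall>\<omega>. linear_map_on scl scl A A (rbop M \<omega>)) \<and>
     linear_map_on scl scl A A (rtwist M) \<and>
     (\<forall>x\<in>A. \<forall>y\<in>A. \<forall>z\<in>A.
        rmult M (rtwist M x) (rmult M y z) = rmult M (rmult M x y) (rtwist M z)) \<and>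
     (\<forall>\<alpha> \<beta>. \<forall>x\<in>A. \<forall>y\<in>A.
        rmult M (rbop M \<alpha> x) (rbop M \<beta> y) =
        rbop M (\<alpha> * \<beta>)
          (rmult M (rbop M \<alpha> x) y + rmult M x (rbop M \<beta> y) + scl lam (rmult M x y))) \<and>
     (\<forall>\<omega>. \<forall>x\<in>A. rbop M \<omega> (rtwist M x) = rtwist M (rbop M \<omega> x))"

text \<open>The ambient space \<open>E\<close> is the whole type.\<close>

definition Exts ::
    "('k::field \<Rightarrow> 'e::ab_group_add \<Rightarrow> 'e) \<Rightarrow> 'k \<Rightarrow> 'e set \<Rightarrow>
     ('s::semigroup_mult, 'e) rbf_struct \<Rightarrow> ('s, 'e) rbf_struct set" where
  "Exts scl lam R M =
     {N. rbf_hom_assoc_algebra scl lam UNIV N \<and>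
         (\<forall>a\<in>R. \<forall>b\<in>R. rmult N a b = rmult M a b) \<and>
         (\<forall>\<omega>. \<forall>a\<in>R. rbop N \<omega> a = rbop M \<omega> a) \<and>
         (\<forall>a\<in>R. rtwist N a = rtwist M a)}"

text \<open>
  The fields are, in order,
  \<open>\<triangleright>\<close>, \<open>\<triangleleft>\<close>, \<open>\<rightharpoonup>\<close>, \<open>\<leftharpoonup>\<close>, \<open>f\<close>, \<open>\<cdot>\<^sub>V\<close>, \<open>(Q\<^sub>\<omega>)\<close>, \<open>(P\<^sub>\<omega>\<^sub>,\<^sub>V)\<close>, \<open>\<eta>\<close>, \<open>\<theta>\<^sub>V\<close>.
\<close>

record ('s, 'r, 'v) ext_datum =
  dtriR :: "'r \<Rightarrow> 'v \<Rightarrow> 'v"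
  dtriL :: "'v \<Rightarrow> 'r \<Rightarrow> 'v"
  dharpR :: "'v \<Rightarrow> 'r \<Rightarrow> 'r"
  dharpL :: "'r \<Rightarrow> 'v \<Rightarrow> 'r"
  dcoc :: "'v \<Rightarrow> 'v \<Rightarrow> 'r"
  dmultV :: "'v \<Rightarrow> 'v \<Rightarrow> 'v"
  dQ :: "'s \<Rightarrow> 'v \<Rightarrow> 'r"
  dPV :: "'s \<Rightarrow> 'v \<Rightarrow> 'v"
  deta :: "'v \<Rightarrow> 'r"
  dtwistV :: "'v \<Rightarrow> 'v"

text \<open>
  HOL functions are total, so a map defined on a carrier set is represented by the function that
  is \<^const>\<open>undefined\<close> off the carrier (\<open>\<rightarrow>\<^sub>E\<close>). Thus two data are equal iff their component maps
  agree on their domains.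
\<close>

definition extending_datum ::
    "('k::field \<Rightarrow> 'r::ab_group_add \<Rightarrow> 'r) \<Rightarrow> ('k \<Rightarrow> 'v::ab_group_add \<Rightarrow> 'v) \<Rightarrow>
     'r set \<Rightarrow> 'v set \<Rightarrow> ('s, 'r, 'v) ext_datum \<Rightarrow> bool" where
  "extending_datum sR sV R V D \<longleftrightarrow>
     dtriR D \<in> R \<rightarrow>\<^sub>E V \<rightarrow>\<^sub>E V \<and> bilinear_map_on sR sV sV R V V (dtriR D) \<and>
     dtriL D \<in> V \<rightarrow>\<^sub>E R \<rightarrow>\<^sub>E V \<and> bilinear_map_on sV sR sV V R V (dtriL D) \<and>
     dharpR D \<in> V \<rightarrow>\<^sub>E R \<rightarrow>\<^sub>E R \<and> bilinear_map_on sV sR sR V R R (dharpR D) \<and>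
     dharpL D \<in> R \<rightarrow>\<^sub>E V \<rightarrow>\<^sub>E R \<and> bilinear_map_on sR sV sR R V R (dharpL D) \<and>
     dcoc D \<in> V \<rightarrow>\<^sub>E V \<rightarrow>\<^sub>E R \<and> bilinear_map_on sV sV sR V V R (dcoc D) \<and>
     dmultV D \<in> V \<rightarrow>\<^sub>E V \<rightarrow>\<^sub>E V \<and> bilinear_map_on sV sV sV V V V (dmultV D) \<and>
     (\<forall>\<omega>. dQ D \<omega> \<in> V \<rightarrow>\<^sub>E R \<and> linear_map_on sV sR V R (dQ D \<omega>)) \<and>
     (\<forall>\<omega>. dPV D \<omega> \<in> V \<rightarrow>\<^sub>E V \<and> linear_map_on sV sV V V (dPV D \<omega>)) \<and>
     deta D \<in> V \<rightarrow>\<^sub>E R \<and> linear_map_on sV sR V R (deta D) \<and>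
     dtwistV D \<in> V \<rightarrow>\<^sub>E V \<and> linear_map_on sV sV V V (dtwistV D)"

definition unified_product ::
    "('s, 'r::ab_group_add) rbf_struct \<Rightarrow> ('s, 'r, 'v::ab_group_add) ext_datum \<Rightarrow>
     ('s, 'r \<times> 'v) rbf_struct" where
  "unified_product M D =
     \<lparr> rmult = (\<lambda>(a, x) (b, y).
         (rmult M a b + dharpL D a y + dharpR D x b + dcoc D x y,
          dtriR D a y + dtriL D x b + dmultV D x y)),
       rbop = (\<lambda>\<omega> (a, x). (rbop M \<omega> a + dQ D \<omega> x, dPV D \<omega> x)),
       rtwist = (\<lambda>(a, x). (rtwist M a + deta D x, dtwistV D x)) \<rparr>"

definition hom_extending_structures ::
    "('k::field \<Rightarrow> 'r::ab_group_add \<Rightarrow> 'r) \<Rightarrow> ('k \<Rightarrow> 'v::ab_group_add \<Rightarrow> 'v) \<Rightarrow> 'k \<Rightarrow>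
     'r set \<Rightarrow> ('s::semigroup_mult, 'r) rbf_struct \<Rightarrow> 'v set \<Rightarrow>
     ('s, 'r, 'v) ext_datum set" where
  "hom_extending_structures sR sV lam R M V =
     {D. extending_datum sR sV R V D \<and>
         rbf_hom_assoc_algebra (module_prod.scale sR sV) lam (R \<times> V) (unified_product M D)}"

definition Upsilon1 ::
    "'e::ab_group_add set \<Rightarrow> 'e set \<Rightarrow> ('e \<Rightarrow> 'e) \<Rightarrow> ('s, 'e) rbf_struct \<Rightarrow>
     ('s, 'e, 'e) ext_datum" where
  "Upsilon1 R V \<rho> N =
     \<lparr> dtriR = (\<lambda>a\<in>R. \<lambda>x\<in>V. rmult N a x - \<rho> (rmult N a x)),
       dtriL = (\<lambda>x\<in>V. \<lambda>a\<in>R. rmult N x a - \<rho> (rmult N x a)),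
       dharpR = (\<lambda>x\<in>V. \<lambda>a\<in>R. \<rho> (rmult N x a)),
       dharpL = (\<lambda>a\<in>R. \<lambda>x\<in>V. \<rho> (rmult N a x)),
       dcoc = (\<lambda>x\<in>V. \<lambda>y\<in>V. \<rho> (rmult N x y)),
       dmultV = (\<lambda>x\<in>V. \<lambda>y\<in>V. rmult N x y - \<rho> (rmult N x y)),
       dQ = (\<lambda>\<omega>. \<lambda>x\<in>V. \<rho> (rbop N \<omega> x)),
       dPV = (\<lambda>\<omega>. \<lambda>x\<in>V. rbop N \<omega> x - \<rho> (rbop N \<omega> x)),
       deta = (\<lambda>x\<in>V. \<rho> (rtwist N x)),
       dtwistV = (\<lambda>x\<in>V. rtwist N x - \<rho> (rtwist N x)) \<rparr>"

end

theory Submission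
  imports Defs
begin

text \<open>
  The map \<open>e \<mapsto> (\<rho> e, e - \<rho> e)\<close> is a linear isomorphism from \<open>E\<close> onto \<open>R \<times> V\<close>, with inverse
  \<open>(a, x) \<mapsto> a + x\<close>. Expanding products bilinearly shows that it carries an extension to
  the unified product of its associated datum. Conversely, the unified product of any extending
  structure can be pulled back to \<open>E\<close>. As all the axioms are identities, they pass to images of
  surjective homomorphisms in both directions.
\<close>

section \<open>Linear and bilinear maps on carrier sets\<close>

lemma linear_map_onI:
  assumes "\<And>x. x \<in> A \<Longrightarrow> f x \<in> B"
    and "\<And>x y. x \<in> A \<Longrightarrow> y \<in> A \<Longrightarrow> f (x + y) = f x + f y"
    and "\<And>c x. x \<in> A \<Longrightarrow> f (s1 c x) = s2 c (f x)"
  shows "linear_map_on s1 s2 A B f"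
  using assms unfolding linear_map_on_def by blast

lemma linear_map_onD:
  assumes "linear_map_on s1 s2 A B f"
  shows linear_map_on_mem: "x \<in> A \<Longrightarrow> f x \<in> B"
    and linear_map_on_add: "x \<in> A \<Longrightarrow> y \<in> A \<Longrightarrow> f (x + y) = f x + f y"
    and linear_map_on_scale: "x \<in> A \<Longrightarrow> f (s1 c x) = s2 c (f x)"
  using assms unfolding linear_map_on_def by blast+

lemma linear_map_on_zero:
  assumes "linear_map_on s1 s2 A B f" "0 \<in> A"
  shows "f 0 = 0"
  using linear_map_on_add[OF assms assms(2)] by simp

text \<open>A subspace is closed under sums and scalings, so every value that linearity compares is
  taken inside \<open>A\<close>, where \<open>g\<close> and \<open>f\<close> agree. This gives
  linearity for maps that are \<open>undefined\<close> off their carrier.\<close>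

lemma linear_map_on_cong:
  assumes "linear_map_on s1 s2 A B f" "module.subspace s1 A" "module s1"
    and "\<And>x. x \<in> A \<Longrightarrow> g x = f x"
  shows "linear_map_on s1 s2 A B g"
  by (rule linear_map_onI)
    (simp_all add: assms(4) linear_map_onD[OF assms(1)]
      module.subspace_add[OF assms(3,2)] module.subspace_scale[OF assms(3,2)])

lemma linear_map_on_compose:
  assumes "linear_map_on s1 s2 A B f" "linear_map_on s2 s3 B C g"
  shows "linear_map_on s1 s3 A C (\<lambda>x. g (f x))"
  by (rule linear_map_onI) (simp_all add: linear_map_onD[OF assms(1)] linear_map_onD[OF assms(2)])

lemma linear_map_on_subset:
  assumes "linear_map_on s1 s2 A B f" "A' \<subseteq> A"
  shows "linear_map_on s1 s2 A' B f"
  using assms unfolding linear_map_on_def by blast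

text \<open>Linearity descends along a surjection: arguments of \<open>k\<close> are lifted along
  \<open>g\<close>, combined in \<open>A\<close>, and evaluated there by \<open>h\<close>.\<close>

lemma linear_map_on_surj_image:
  assumes g: "linear_map_on s1 s2 A B g" and h: "linear_map_on s1 s3 A C h"
    and A: "module s1" "module.subspace s1 A" and surj: "g ` A = B"
    and comm: "\<And>x. x \<in> A \<Longrightarrow> k (g x) = h x"
  shows "linear_map_on s2 s3 B C k"
proof (rule linear_map_onI)
  fix x assume "x \<in> B"
  then obtain a where a: "a \<in> A" "x = g a" using surj by blast
  show "k x \<in> C" using a comm linear_map_onD[OF h] by simp
  show "k (s2 c x) = s3 c (k x)" for c
    using a comm linear_map_onD[OF h] linear_map_onD[OF g] module.subspace_scale[OF A]
    by metis
  fix y assume "y \<in> B"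
  then obtain b where b: "b \<in> A" "y = g b" using surj by blast
  show "k (x + y) = k x + k y"
    using a b comm linear_map_onD[OF h] linear_map_onD[OF g] module.subspace_add[OF A]
    by metis
qed

lemma bilinear_map_onI:
  assumes "\<And>x. x \<in> A \<Longrightarrow> linear_map_on s2 s3 B C (\<lambda>y. f x y)"
    and "\<And>y. y \<in> B \<Longrightarrow> linear_map_on s1 s3 A C (\<lambda>x. f x y)"
  shows "bilinear_map_on s1 s2 s3 A B C f"
  using assms unfolding bilinear_map_on_def by blast

lemma bilinear_map_onD:
  assumes "bilinear_map_on s1 s2 s3 A B C f"
  shows "x \<in> A \<Longrightarrow> linear_map_on s2 s3 B C (\<lambda>y. f x y)"
    and "y \<in> B \<Longrightarrow> linear_map_on s1 s3 A C (\<lambda>x. f x y)"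
  using assms unfolding bilinear_map_on_def by blast+

lemma bilinear_map_on_zero:
  assumes "bilinear_map_on s1 s2 s3 A B C f"
  shows "x \<in> A \<Longrightarrow> 0 \<in> B \<Longrightarrow> f x 0 = 0" and "y \<in> B \<Longrightarrow> 0 \<in> A \<Longrightarrow> f 0 y = 0"
  using linear_map_on_zero[OF bilinear_map_onD(1)[OF assms]]
    linear_map_on_zero[OF bilinear_map_onD(2)[OF assms]] by blast+

lemma linear_map_on_restrict:
  assumes "linear_map_on s s UNIV UNIV f" "linear_map_on s s UNIV C g"
    and "module s" "module.subspace s A"
  shows "linear_map_on s s A C (\<lambda>x\<in>A. g (f x))"
  by (rule linear_map_on_cong[OF linear_map_on_subset[OF linear_map_on_compose[OF assms(1,2)]
          subset_UNIV] assms(4,3)]) simp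

text \<open>The shape of the bilinear components of \<open>Upsilon1\<close>: a product on the whole
  space, followed by the projection to \<open>R\<close> or to \<open>V\<close>, and cut down to the
  carriers.\<close>

lemma bilinear_map_on_restrict:
  assumes f: "bilinear_map_on s s s UNIV UNIV UNIV f" and g: "linear_map_on s s UNIV C g"
    and s: "module s" and A: "module.subspace s A" and B: "module.subspace s B"
  shows "bilinear_map_on s s s A B C (\<lambda>x\<in>A. \<lambda>y\<in>B. g (f x y))"
proof (rule bilinear_map_onI)
  fix x assume x: "x \<in> A"
  show "linear_map_on s s B C (\<lambda>y. (\<lambda>x\<in>A. \<lambda>y\<in>B. g (f x y)) x y)"
    using linear_map_on_restrict[OF bilinear_map_onD(1)[OF f UNIV_I, of x] g s B] x
    by (simp add: restrict_def)
next
  fix y assume y: "y \<in> B"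
  show "linear_map_on s s A C (\<lambda>x. (\<lambda>x\<in>A. \<lambda>y\<in>B. g (f x y)) x y)"
    by (rule linear_map_on_cong[OF linear_map_on_restrict[OF bilinear_map_onD(2)[OF f UNIV_I, of y]
            g s A] A s]) (simp add: y)
qed

section \<open>Transport of the algebra axioms along surjective homomorphisms\<close>

lemma rbf_hom_assoc_algebraD:
  assumes "rbf_hom_assoc_algebra scl lam A M"
  shows "vector_space scl" "module scl" "module.subspace scl A"
    and "bilinear_map_on scl scl scl A A A (rmult M)"
    and "linear_map_on scl scl A A (rbop M \<omega>)"
    and "linear_map_on scl scl A A (rtwist M)"
  using assms unfolding rbf_hom_assoc_algebra_def by (simp_all add: module_iff_vector_space)

text \<open>Elements of \<open>B\<close> are lifted along \<open>g\<close>, each identity is applied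
  in \<open>A\<close>, and the result is carried back by \<open>g\<close>. Even the linearity of the
  operations of \<open>N\<close> comes from \<open>M\<close>, so only the three intertwining
  equations have to be checked for \<open>N\<close>.\<close>

lemma rbf_hom_assoc_algebra_surj_image:
  assumes M: "rbf_hom_assoc_algebra s1 lam A M"
    and s2: "vector_space s2" and B: "module.subspace s2 B"
    and g: "linear_map_on s1 s2 A B g" and surj: "g ` A = B"
    and mult: "\<And>x y. x \<in> A \<Longrightarrow> y \<in> A \<Longrightarrow> rmult N (g x) (g y) = g (rmult M x y)"
    and bop: "\<And>\<omega> x. x \<in> A \<Longrightarrow> rbop N \<omega> (g x) = g (rbop M \<omega> x)"
    and twist: "\<And>x. x \<in> A \<Longrightarrow> rtwist N (g x) = g (rtwist M x)"
  shows "rbf_hom_assoc_algebra s2 lam B N"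
proof -
  note D = rbf_hom_assoc_algebraD[OF M]
  have memM: "rmult M x y \<in> A" if "x \<in> A" "y \<in> A" for x y
    using that bilinear_map_onD(1)[OF D(4), THEN linear_map_on_mem] by blast
  have memP: "rbop M \<omega> x \<in> A" if "x \<in> A" for \<omega> x
    using that linear_map_on_mem[OF D(5)] by blast
  have memT: "rtwist M x \<in> A" if "x \<in> A" for x
    using that linear_map_on_mem[OF D(6)] by blast
  have memadd: "x + y \<in> A" if "x \<in> A" "y \<in> A" for x y
    using that module.subspace_add[OF D(2,3)] by blast
  have memscl: "s1 c x \<in> A" if "x \<in> A" for c x
    using that module.subspace_scale[OF D(2,3)] by blast
  note mem = memM memP memT memadd memscl
  note lin = linear_map_on_add[OF g] linear_map_on_scale[OF g]
  have bil: "bilinear_map_on s2 s2 s2 B B B (rmult N)"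
  proof (rule bilinear_map_onI)
    fix x assume "x \<in> B"
    then obtain a where a: "a \<in> A" "x = g a" using surj by blast
    \<comment> \<open>For \<open>x = g a\<close>, multiplication by \<open>x\<close> composed with
      \<open>g\<close> equals multiplication by \<open>a\<close> followed by \<open>g\<close>, which
      is linear on \<open>A\<close>.\<close>
    show "linear_map_on s2 s2 B B (\<lambda>y. rmult N x y)"
      by (rule linear_map_on_surj_image[OF g
            linear_map_on_compose[OF bilinear_map_onD(1)[OF D(4) a(1)] g] D(2,3) surj])
        (simp add: a mult)
    show "linear_map_on s2 s2 B B (\<lambda>y. rmult N y x)"
      by (rule linear_map_on_surj_image[OF g
            linear_map_on_compose[OF bilinear_map_onD(2)[OF D(4) a(1)] g] D(2,3) surj])
        (simp add: a mult)
  qed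
  have P: "linear_map_on s2 s2 B B (rbop N \<omega>)" for \<omega>
    by (rule linear_map_on_surj_image[OF g linear_map_on_compose[OF D(5) g] D(2,3) surj])
      (simp add: bop)
  have T: "linear_map_on s2 s2 B B (rtwist N)"
    by (rule linear_map_on_surj_image[OF g linear_map_on_compose[OF D(6) g] D(2,3) surj])
      (simp add: twist)
  have assoc: "rmult N (rtwist N x) (rmult N y z) = rmult N (rmult N x y) (rtwist N z)"
    if "x \<in> B" "y \<in> B" "z \<in> B" for x y z
  proof -
    from that surj obtain a b c where "a \<in> A" "b \<in> A" "c \<in> A" "x = g a" "y = g b" "z = g c"
      by blast
    moreover from this have "rmult M (rtwist M a) (rmult M b c) = rmult M (rmult M a b) (rtwist M c)"
      using M unfolding rbf_hom_assoc_algebra_def by blast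
    ultimately show ?thesis by (simp add: mult twist mem)
  qed
  have rb: "rmult N (rbop N \<alpha> x) (rbop N \<beta> y) =
      rbop N (\<alpha> * \<beta>) (rmult N (rbop N \<alpha> x) y + rmult N x (rbop N \<beta> y) + s2 lam (rmult N x y))"
    if "x \<in> B" "y \<in> B" for \<alpha> \<beta> x y
  proof -
    from that surj obtain a b where "a \<in> A" "b \<in> A" "x = g a" "y = g b"
      by blast
    moreover from this have "rmult M (rbop M \<alpha> a) (rbop M \<beta> b) =
      rbop M (\<alpha> * \<beta>) (rmult M (rbop M \<alpha> a) b + rmult M a (rbop M \<beta> b) + s1 lam (rmult M a b))"
      using M unfolding rbf_hom_assoc_algebra_def by blast
    \<comment> \<open>Linearity of \<open>g\<close> is used from right to left: the three summands,
      including the one of weight \<open>lam\<close>, must be collected into a single value of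
      \<open>g\<close> before \<open>bop\<close> applies.\<close>
    ultimately show ?thesis by (simp add: mult bop mem flip: lin)
  qed
  have comm: "rbop N \<omega> (rtwist N x) = rtwist N (rbop N \<omega> x)" if "x \<in> B" for \<omega> x
  proof -
    from that surj obtain a where "a \<in> A" "x = g a"
      by blast
    moreover from this have "rbop M \<omega> (rtwist M a) = rtwist M (rbop M \<omega> a)"
      using M unfolding rbf_hom_assoc_algebra_def by blast
    ultimately show ?thesis by (simp add: twist bop mem)
  qed
  show ?thesis
    unfolding rbf_hom_assoc_algebra_def using s2 B bil P T assoc rb comm by blast
qed

section \<open>Product spaces and the pullback of a unified product\<close>

lemma vector_space_prod_scale:
  assumes "vector_space s1" "vector_space s2"
  shows "vector_space (module_prod.scale s1 s2)"
proof -
  interpret vector_space_prod s1 s2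
    using assms by (simp add: vector_space_prod_def vector_space_pair_def)
  show ?thesis by unfold_locales
qed

lemma prod_scale_apply:
  assumes "vector_space s1" "vector_space s2"
  shows "module_prod.scale s1 s2 c (x, y) = (s1 c x, s2 c y)"
proof -
  interpret vector_space_prod s1 s2
    using assms by (simp add: vector_space_prod_def vector_space_pair_def)
  show ?thesis by (simp add: scale_def)
qed

lemma subspace_prod_Times:
  assumes "vector_space s1" "vector_space s2" "module.subspace s1 A" "module.subspace s2 B"
  shows "module.subspace (module_prod.scale s1 s2) (A \<times> B)"
proof -
  interpret vector_space_prod s1 s2
    using assms by (simp add: vector_space_prod_def vector_space_pair_def)
  show ?thesis using assms(3,4) by (rule subspace_Times)
qed

text \<open>This becomes the inverse of \<open>Upsilon1\<close>. It takes \<open>M\<close> as an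
  argument because a datum does not record the operations on \<open>R\<close> itself.\<close>

definition pullback_struct ::
    "('e \<Rightarrow> 'e) \<Rightarrow> ('s, 'e) rbf_struct \<Rightarrow> ('s, 'e, 'e) ext_datum \<Rightarrow>
     ('s, 'e::ab_group_add) rbf_struct" where
  "pullback_struct \<rho> M D =
     (let split = (\<lambda>e. (\<rho> e, e - \<rho> e)); U = unified_product M D in
     \<lparr> rmult = (\<lambda>e e'. case rmult U (split e) (split e') of (a, x) \<Rightarrow> a + x),
       rbop = (\<lambda>\<omega> e. case rbop U \<omega> (split e) of (a, x) \<Rightarrow> a + x),
       rtwist = (\<lambda>e. case rtwist U (split e) of (a, x) \<Rightarrow> a + x) \<rparr>)"

section \<open>The splitting of the ambient space given by the retraction\<close>

locale rbf_retraction = vector_space scl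
  for scl :: "'k::field \<Rightarrow> 'e::ab_group_add \<Rightarrow> 'e" +
  fixes lam :: 'k
    and R V :: "'e set"
    and M :: "('s::semigroup_mult, 'e) rbf_struct"
    and \<rho> :: "'e \<Rightarrow> 'e"
  assumes subspace_R: "subspace R"
    and algebra_M: "rbf_hom_assoc_algebra scl lam R M"
    and linear_rho: "Vector_Spaces.linear scl scl \<rho>"
    and rho_mem: "\<rho> e \<in> R"
    and rho_id: "a \<in> R \<Longrightarrow> \<rho> a = a"
    and V_eq: "V = {x. \<rho> x = 0}"
begin

lemma rho_add: "\<rho> (x + y) = \<rho> x + \<rho> y"
  and rho_scale: "\<rho> (scl c x) = scl c (\<rho> x)"
  using linear_rho
  by (simp_all add: Vector_Spaces.linear_def module_hom_def module_hom_axioms_def module_hom_iff)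

lemma rho_zero: "\<rho> 0 = 0"
  using rho_add[of 0 0] by simp

lemma rho_diff: "\<rho> (x - y) = \<rho> x - \<rho> y"
  using rho_add[of "x - y" y] by simp

lemma rho_V: "x \<in> V \<Longrightarrow> \<rho> x = 0"
  by (simp add: V_eq)

text \<open>The retraction takes values in \<open>R\<close> and fixes \<open>R\<close>, so it is
  idempotent and kills the difference.\<close>

lemma diff_rho_mem: "e - \<rho> e \<in> V"
  by (simp add: V_eq rho_diff rho_id rho_mem)

lemma subspace_V: "subspace V"
  by (rule subspaceI) (simp_all add: V_eq rho_zero rho_add rho_scale)

lemma zero_mem: "0 \<in> R" "0 \<in> V"
  using subspace_0 subspace_R subspace_V by blast+

lemma vs: "vector_space scl"
  by unfold_locales

lemma mod: "module scl"
  by unfold_locales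

lemma linear_on_rho: "linear_map_on scl scl UNIV R \<rho>"
  by (rule linear_map_onI) (simp_all add: rho_mem rho_add rho_scale)

lemma linear_on_diff_rho: "linear_map_on scl scl UNIV V (\<lambda>e. e - \<rho> e)"
  by (rule linear_map_onI) (simp_all add: diff_rho_mem rho_add rho_scale scale_right_diff_distrib)

lemma linear_on_split:
  "linear_map_on scl (module_prod.scale scl scl) UNIV (R \<times> V) (\<lambda>e. (\<rho> e, e - \<rho> e))"
  by (rule linear_map_onI)
    (simp_all add: diff_rho_mem rho_mem rho_add rho_scale scale_right_diff_distrib
      prod_scale_apply[OF vs vs])

lemma linear_on_join:
  "linear_map_on (module_prod.scale scl scl) scl (R \<times> V) UNIV (\<lambda>(a, x). a + x)"
  by (rule linear_map_onI)
    (auto simp: scale_right_distrib prod_scale_apply[OF vs vs])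

text \<open>The retraction fixes \<open>a\<close> and kills \<open>x\<close>. Hence the
  decomposition into a part in \<open>R\<close> and a part in \<open>V\<close> is unique, and the
  terms of a sum can be read off.\<close>

lemma split_join: "a \<in> R \<Longrightarrow> x \<in> V \<Longrightarrow> \<rho> (a + x) = a"
  by (simp add: rho_add rho_id rho_V)

lemma split_surj: "range (\<lambda>e. (\<rho> e, e - \<rho> e)) = R \<times> V"
proof (intro equalityI subsetI)
  fix p assume "p \<in> R \<times> V"
  then have "p = (\<lambda>e. (\<rho> e, e - \<rho> e)) (fst p + snd p)"
    by (auto simp: split_join)
  then show "p \<in> range (\<lambda>e. (\<rho> e, e - \<rho> e))" by (rule range_eqI)
qed (auto simp: rho_mem diff_rho_mem)

lemma join_surj: "(\<lambda>(a, x). a + x) ` (R \<times> V) = UNIV"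
proof -
  have "e \<in> (\<lambda>(a, x). a + x) ` (R \<times> V)" for e
    by (rule image_eqI[of _ _ "(\<rho> e, e - \<rho> e)"]) (simp_all add: rho_mem diff_rho_mem)
  then show ?thesis by blast
qed

section \<open>From extensions to extending structures\<close>

lemma ExtsD:
  assumes "N \<in> Exts scl lam R M"
  shows "rbf_hom_assoc_algebra scl lam UNIV N"
    and "a \<in> R \<Longrightarrow> b \<in> R \<Longrightarrow> rmult N a b = rmult M a b"
    and "a \<in> R \<Longrightarrow> rbop N \<omega> a = rbop M \<omega> a"
    and "a \<in> R \<Longrightarrow> rtwist N a = rtwist M a"
  using assms unfolding Exts_def by blast+

lemma memM:
  "a \<in> R \<Longrightarrow> b \<in> R \<Longrightarrow> rmult M a b \<in> R"
  "a \<in> R \<Longrightarrow> rbop M \<omega> a \<in> R"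
  "a \<in> R \<Longrightarrow> rtwist M a \<in> R"
  using rbf_hom_assoc_algebraD[OF algebra_M] bilinear_map_onD(1) linear_map_on_mem by blast+

text \<open>Splitting a vector is a homomorphism from the extension to the unified product.
  Expanding along \<open>R\<close> and \<open>V\<close> gives one term lying purely in
  \<open>R\<close>, computed by \<open>M\<close>, and the other terms divide into the components of
  the datum.\<close>

lemma Exts_split:
  assumes N: "N \<in> Exts scl lam R M"
  defines "U \<equiv> unified_product M (Upsilon1 R V \<rho> N)"
  shows "rmult U (\<rho> e, e - \<rho> e) (\<rho> e', e' - \<rho> e') = (\<rho> (rmult N e e'), rmult N e e' - \<rho> (rmult N e e'))"
    and "rbop U \<omega> (\<rho> e, e - \<rho> e) = (\<rho> (rbop N \<omega> e), rbop N \<omega> e - \<rho> (rbop N \<omega> e))"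
    and "rtwist U (\<rho> e, e - \<rho> e) = (\<rho> (rtwist N e), rtwist N e - \<rho> (rtwist N e))"
proof -
  note D = rbf_hom_assoc_algebraD[OF ExtsD(1)[OF N]]
  let ?x = "e - \<rho> e" and ?y = "e' - \<rho> e'"
  have "rmult N e e' = rmult N (\<rho> e + ?x) (\<rho> e' + ?y)" by simp
  also have "\<dots> = rmult N (\<rho> e) (\<rho> e') + rmult N (\<rho> e) ?y + rmult N ?x (\<rho> e') + rmult N ?x ?y"
    by (simp only: linear_map_on_add[OF bilinear_map_onD(1)[OF D(4)]]
        linear_map_on_add[OF bilinear_map_onD(2)[OF D(4)]] UNIV_I add_ac)
  \<comment> \<open>This is where \<open>N\<close> restricting to \<open>M\<close> on
    \<open>R\<close> enters.\<close>
  also have "rmult N (\<rho> e) (\<rho> e') = rmult M (\<rho> e) (\<rho> e')"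
    by (simp add: ExtsD(2)[OF N] rho_mem)
  finally have m: "rmult N e e' =
    rmult M (\<rho> e) (\<rho> e') + rmult N (\<rho> e) ?y + rmult N ?x (\<rho> e') + rmult N ?x ?y" .
  show "rmult U (\<rho> e, e - \<rho> e) (\<rho> e', e' - \<rho> e') =
      (\<rho> (rmult N e e'), rmult N e e' - \<rho> (rmult N e e'))"
    \<comment> \<open>The term from \<open>M\<close> lies in \<open>R\<close>, so \<rho> fixes it
      and it cancels from the \<open>V\<close> component. Each of the other three terms contributes
      its image under \<rho> to the first component and the remainder to the second.\<close>
    unfolding m
    by (simp add: U_def unified_product_def Upsilon1_def rho_mem diff_rho_mem rho_add
        rho_id memM)
  have "rbop N \<omega> e = rbop N \<omega> (\<rho> e + ?x)" by simp
  also have "\<dots> = rbop M \<omega> (\<rho> e) + rbop N \<omega> ?x"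
    by (simp only: linear_map_on_add[OF D(5)] UNIV_I ExtsD(3)[OF N] rho_mem)
  finally have p: "rbop N \<omega> e = rbop M \<omega> (\<rho> e) + rbop N \<omega> ?x" .
  show "rbop U \<omega> (\<rho> e, e - \<rho> e) = (\<rho> (rbop N \<omega> e), rbop N \<omega> e - \<rho> (rbop N \<omega> e))"
    unfolding p
    by (simp add: U_def unified_product_def Upsilon1_def rho_mem diff_rho_mem rho_add
        rho_id memM)
  have "rtwist N e = rtwist N (\<rho> e + ?x)" by simp
  also have "\<dots> = rtwist M (\<rho> e) + rtwist N ?x"
    by (simp only: linear_map_on_add[OF D(6)] UNIV_I ExtsD(4)[OF N] rho_mem)
  finally have t: "rtwist N e = rtwist M (\<rho> e) + rtwist N ?x" .
  show "rtwist U (\<rho> e, e - \<rho> e) = (\<rho> (rtwist N e), rtwist N e - \<rho> (rtwist N e))"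
    unfolding t
    by (simp add: U_def unified_product_def Upsilon1_def rho_mem diff_rho_mem rho_add
        rho_id memM)
qed

lemma extending_datum_Upsilon1:
  assumes "N \<in> Exts scl lam R M"
  shows "extending_datum scl scl R V (Upsilon1 R V \<rho> N)"
proof -
  note D = rbf_hom_assoc_algebraD[OF ExtsD(1)[OF assms]]
  note B = bilinear_map_on_restrict[OF D(4) linear_on_rho mod]
    bilinear_map_on_restrict[OF D(4) linear_on_diff_rho mod]
  note L = linear_map_on_restrict[OF _ linear_on_rho mod subspace_V]
    linear_map_on_restrict[OF _ linear_on_diff_rho mod subspace_V]
  show ?thesis
    unfolding extending_datum_def Upsilon1_def
    by (simp add: B subspace_R subspace_V L D rho_mem diff_rho_mem)
qed

text \<open>By \<open>Exts_split\<close> the splitting map intertwines the operations, and it is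
  onto \<open>R \<times> V\<close>, so the axioms pass from \<open>N\<close> to the unified
  product.\<close>

lemma Upsilon1_mem:
  assumes "N \<in> Exts scl lam R M"
  shows "Upsilon1 R V \<rho> N \<in> hom_extending_structures scl scl lam R M V"
  unfolding hom_extending_structures_def
  using extending_datum_Upsilon1[OF assms]
    rbf_hom_assoc_algebra_surj_image[OF ExtsD(1)[OF assms] vector_space_prod_scale[OF vs vs]
      subspace_prod_Times[OF vs vs subspace_R subspace_V] linear_on_split split_surj
      Exts_split[OF assms]]
  by blast

section \<open>From extending structures back to extensions\<close>

lemma pullback_struct_Upsilon1:
  assumes "N \<in> Exts scl lam R M"
  shows "pullback_struct \<rho> M (Upsilon1 R V \<rho> N) = N"
  \<comment> \<open>The two components in \<open>Exts_split\<close> add up to the operation of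
    \<open>N\<close>. As the extension lives on the whole type, agreement at all arguments is
    equality of the structures.\<close>
  by (rule rbf_struct.equality) (simp_all add: pullback_struct_def Let_def Exts_split[OF assms])

text \<open>By \<open>split_join\<close> the vector \<open>a + x\<close> splits back into
  \<open>(a, x)\<close>, so adding components turns the unified product into the pulled back
  operations.\<close>

lemma pullback_struct_sel:
  assumes "a \<in> R" "x \<in> V"
  shows "b \<in> R \<Longrightarrow> y \<in> V \<Longrightarrow> rmult (pullback_struct \<rho> M D) (a + x) (b + y) =
      (rmult M a b + dharpL D a y + dharpR D x b + dcoc D x y)
        + (dtriR D a y + dtriL D x b + dmultV D x y)"
    and "rbop (pullback_struct \<rho> M D) \<omega> (a + x) = (rbop M \<omega> a + dQ D \<omega> x) + dPV D \<omega> x"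
    and "rtwist (pullback_struct \<rho> M D) (a + x) = (rtwist M a + deta D x) + dtwistV D x"
  using assms by (simp_all add: pullback_struct_def unified_product_def split_join)

text \<open>Used to isolate single terms of the unified product by setting one coordinate of each
  argument to zero.\<close>

lemma datum_zero:
  assumes "extending_datum scl scl R V D"
  shows "a \<in> R \<Longrightarrow> dtriR D a 0 = 0" "x \<in> V \<Longrightarrow> dtriR D 0 x = 0"
    "a \<in> R \<Longrightarrow> dtriL D 0 a = 0" "x \<in> V \<Longrightarrow> dtriL D x 0 = 0"
    "a \<in> R \<Longrightarrow> dharpR D 0 a = 0" "x \<in> V \<Longrightarrow> dharpR D x 0 = 0"
    "a \<in> R \<Longrightarrow> dharpL D a 0 = 0" "x \<in> V \<Longrightarrow> dharpL D 0 x = 0"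
    "x \<in> V \<Longrightarrow> dcoc D x 0 = 0" "x \<in> V \<Longrightarrow> dcoc D 0 x = 0"
    "x \<in> V \<Longrightarrow> dmultV D x 0 = 0" "x \<in> V \<Longrightarrow> dmultV D 0 x = 0"
    "dQ D \<omega> 0 = 0" "dPV D \<omega> 0 = 0" "deta D 0 = 0" "dtwistV D 0 = 0"
  using assms unfolding extending_datum_def
  by (blast intro: zero_mem bilinear_map_on_zero linear_map_on_zero)+

lemma M_zero:
  "a \<in> R \<Longrightarrow> rmult M a 0 = 0" "a \<in> R \<Longrightarrow> rmult M 0 a = 0" "rbop M \<omega> 0 = 0" "rtwist M 0 = 0"
  using rbf_hom_assoc_algebraD[OF algebra_M]
  by (blast intro: zero_mem bilinear_map_on_zero linear_map_on_zero)+

lemma pullback_struct_mem: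
  assumes D: "D \<in> hom_extending_structures scl scl lam R M V"
  shows "pullback_struct \<rho> M D \<in> Exts scl lam R M"
proof -
  have datum: "extending_datum scl scl R V D"
    and U: "rbf_hom_assoc_algebra (module_prod.scale scl scl) lam (R \<times> V) (unified_product M D)"
    using D unfolding hom_extending_structures_def by blast+
  have alg: "rbf_hom_assoc_algebra scl lam UNIV (pullback_struct \<rho> M D)"
    \<comment> \<open>Transport in the opposite direction to \<open>Upsilon1_mem\<close>, now along
      the addition map from \<open>R \<times> V\<close>.\<close>
    by (rule rbf_hom_assoc_algebra_surj_image[OF U vs subspace_UNIV linear_on_join join_surj])
      (auto simp: pullback_struct_sel unified_product_def)
  show ?thesis
    unfolding Exts_def
    \<comment> \<open>A vector of \<open>R\<close> is read as \<open>a + 0\<close>; every term from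
      the datum then vanishes and only the operation of \<open>M\<close> survives.\<close>
    using alg pullback_struct_sel(1)[OF _ zero_mem(2) _ zero_mem(2), where D = D]
      pullback_struct_sel(2,3)[OF _ zero_mem(2), where D = D]
    by (simp add: datum_zero[OF datum] zero_mem)
qed

lemma Upsilon1_pullback_struct:
  assumes D: "D \<in> hom_extending_structures scl scl lam R M V"
  shows "Upsilon1 R V \<rho> (pullback_struct \<rho> M D) = D"
proof -
  have datum: "extending_datum scl scl R V D"
    using D unfolding hom_extending_structures_def by blast
  have maps: "dtriR D \<in> R \<rightarrow>\<^sub>E V \<rightarrow>\<^sub>E V" "dtriL D \<in> V \<rightarrow>\<^sub>E R \<rightarrow>\<^sub>E V" "dharpR D \<in> V \<rightarrow>\<^sub>E R \<rightarrow>\<^sub>E R"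
    "dharpL D \<in> R \<rightarrow>\<^sub>E V \<rightarrow>\<^sub>E R" "dcoc D \<in> V \<rightarrow>\<^sub>E V \<rightarrow>\<^sub>E R" "dmultV D \<in> V \<rightarrow>\<^sub>E V \<rightarrow>\<^sub>E V"
    "\<forall>\<omega>. dQ D \<omega> \<in> V \<rightarrow>\<^sub>E R \<and> linear_map_on scl scl V R (dQ D \<omega>)"
    "\<forall>\<omega>. dPV D \<omega> \<in> V \<rightarrow>\<^sub>E V \<and> linear_map_on scl scl V V (dPV D \<omega>)"
    "deta D \<in> V \<rightarrow>\<^sub>E R" "dtwistV D \<in> V \<rightarrow>\<^sub>E V"
    using datum unfolding extending_datum_def by - (elim conjE, assumption)+
  note e = maps(1-6) maps(7,8)[rule_format, THEN conjunct1] maps(9,10)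
  \<comment> \<open>Both sides are \<open>undefined\<close> off \<open>A\<close> and, at each point
    of \<open>A\<close>, off \<open>B\<close>, so agreement on the carriers gives equality of
    functions.\<close>
  have curried: "(\<lambda>x\<in>A. \<lambda>y\<in>B. h x y) = f"
    if "f \<in> A \<rightarrow>\<^sub>E B \<rightarrow>\<^sub>E C" "\<And>x y. x \<in> A \<Longrightarrow> y \<in> B \<Longrightarrow> h x y = f x y"
    for A B C :: "'e set" and f h :: "'e \<Rightarrow> 'e \<Rightarrow> 'e"
  proof (rule extensionalityI[of _ A])
    fix x assume x: "x \<in> A"
    show "(\<lambda>x\<in>A. \<lambda>y\<in>B. h x y) x = f x"
      using x that PiE_mem[OF that(1) x] by (auto intro!: extensionalityI[of _ B] simp: PiE_iff)
  qed (use that in \<open>auto simp: PiE_iff\<close>)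
  have single: "(\<lambda>x\<in>A. h x) = f" if "f \<in> A \<rightarrow>\<^sub>E C" "\<And>x. x \<in> A \<Longrightarrow> h x = f x"
    for A C :: "'e set" and f h :: "'e \<Rightarrow> 'e"
    using that by (auto intro!: extensionalityI[of _ A] simp: PiE_iff)
  let ?N = "pullback_struct \<rho> M D"
  \<comment> \<open>With the arguments read as \<open>a + 0\<close> and \<open>0 + x\<close>, only
    one mixed pair survives: a term in \<open>R\<close> plus a term in \<open>V\<close>.\<close>
  have RV: "rmult ?N a x = dharpL D a x + dtriR D a x" if "a \<in> R" "x \<in> V" for a x
    using that pullback_struct_sel(1)[of a 0 0 x D]
    by (simp add: zero_mem M_zero datum_zero[OF datum])
  have VR: "rmult ?N x a = dharpR D x a + dtriL D x a" if "a \<in> R" "x \<in> V" for a x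
    using that pullback_struct_sel(1)[of 0 x a 0 D]
    by (simp add: zero_mem M_zero datum_zero[OF datum])
  have VV: "rmult ?N x y = dcoc D x y + dmultV D x y" if "x \<in> V" "y \<in> V" for x y
    using that pullback_struct_sel(1)[of 0 x 0 y D]
    by (simp add: zero_mem M_zero datum_zero[OF datum])
  have P: "rbop ?N \<omega> x = dQ D \<omega> x + dPV D \<omega> x" if "x \<in> V" for \<omega> x
    using that pullback_struct_sel(2)[of 0 x D \<omega>] by (simp add: zero_mem M_zero)
  have T: "rtwist ?N x = deta D x + dtwistV D x" if "x \<in> V" for x
    using that pullback_struct_sel(3)[of 0 x D] by (simp add: zero_mem M_zero)
  note mem2 = e(1-6)[THEN PiE_mem, THEN PiE_mem] and mem1 = e(7-10)[THEN PiE_mem]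
  show ?thesis
  proof (rule ext_datum.equality)
    show "dtriR (Upsilon1 R V \<rho> ?N) = dtriR D"
      unfolding Upsilon1_def ext_datum.select_convs
      \<comment> \<open>Here and below, \<rho> extracts the \<open>R\<close> term of the sum, and
        subtracting it leaves the \<open>V\<close> term; \<open>mem2\<close> and \<open>mem1\<close>
        supply the memberships that \<open>split_join\<close> requires.\<close>
      by (rule curried[OF e(1)]) (simp add: RV VR VV split_join mem2)
    show "dtriL (Upsilon1 R V \<rho> ?N) = dtriL D"
      unfolding Upsilon1_def ext_datum.select_convs
      by (rule curried[OF e(2)]) (simp add: RV VR VV split_join mem2)
    show "dharpR (Upsilon1 R V \<rho> ?N) = dharpR D"
      unfolding Upsilon1_def ext_datum.select_convs
      by (rule curried[OF e(3)]) (simp add: RV VR VV split_join mem2)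
    show "dharpL (Upsilon1 R V \<rho> ?N) = dharpL D"
      unfolding Upsilon1_def ext_datum.select_convs
      by (rule curried[OF e(4)]) (simp add: RV VR VV split_join mem2)
    show "dcoc (Upsilon1 R V \<rho> ?N) = dcoc D"
      unfolding Upsilon1_def ext_datum.select_convs
      by (rule curried[OF e(5)]) (simp add: RV VR VV split_join mem2)
    show "dmultV (Upsilon1 R V \<rho> ?N) = dmultV D"
      unfolding Upsilon1_def ext_datum.select_convs
      by (rule curried[OF e(6)]) (simp add: RV VR VV split_join mem2)
    show "dQ (Upsilon1 R V \<rho> ?N) = dQ D"
      unfolding Upsilon1_def ext_datum.select_convs
      by (rule ext, rule single[OF e(7)]) (simp add: P split_join mem1)
    show "dPV (Upsilon1 R V \<rho> ?N) = dPV D"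
      unfolding Upsilon1_def ext_datum.select_convs
      by (rule ext, rule single[OF e(8)]) (simp add: P split_join mem1)
    show "deta (Upsilon1 R V \<rho> ?N) = deta D"
      unfolding Upsilon1_def ext_datum.select_convs
      by (rule single[OF e(9)]) (simp add: T split_join mem1)
    show "dtwistV (Upsilon1 R V \<rho> ?N) = dtwistV D"
      unfolding Upsilon1_def ext_datum.select_convs
      by (rule single[OF e(10)]) (simp add: T split_join mem1)
  qed simp
qed

end

theorem proposition3p8:
  fixes scl :: "'k::field \<Rightarrow> 'e::ab_group_add \<Rightarrow> 'e"
    and lam :: 'k
    and R V :: "'e set"
    and M :: "('s::semigroup_mult, 'e) rbf_struct"
    and \<rho> :: "'e \<Rightarrow> 'e"
  assumes "vector_space scl"
    and "module.subspace scl R"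
    and "rbf_hom_assoc_algebra scl lam R M"
    and "Vector_Spaces.linear scl scl \<rho>"
    and "\<rho> \<in> UNIV \<rightarrow> R"
    and "\<forall>a\<in>R. \<rho> a = a"
    and "V = {x. \<rho> x = 0}"
  shows "bij_betw (Upsilon1 R V \<rho>) (Exts scl lam R M)
           (hom_extending_structures scl scl lam R M V)"
proof -
  interpret rbf_retraction scl lam R V M \<rho>
    using assms by (auto simp: rbf_retraction_def rbf_retraction_axioms_def)
  show ?thesis
    by (rule bij_betw_byWitness[where f' = "pullback_struct \<rho> M"])
      (auto simp: pullback_struct_Upsilon1 Upsilon1_pullback_struct Upsilon1_mem
        pullback_struct_mem)
qed

end
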